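(* Let $\langle M,\mathcal{X}\rangle$ and $\langle N,\mathcal{Y}\rangle$ be models of ${\rm GBC}^-$ with $M\subseteq N$, $\mathcal{X}\subseteq\mathcal{Y}$, and with $M$ and $N$ having the same ordinals. Then for every relation $\vartriangleleft\in\mathcal{X}$, $\langle M,\mathcal{X}\rangle$ satisfies that $\vartriangleleft$ is well-founded if and only if $\langle N,\mathcal{Y}\rangle$ satisfies that $\vartriangleleft$ is well-founded.
   Context: ${\rm GBC}^-$ is Gödel–Bernays set theory without the power set axiom and with global choice in the form of a class bijection between the universe of sets and the class of ordinals. A model $\langle M,\mathcal{X}\rangle$ has first-order part $M$ (the sets) and classes $\mathcal{X}$. A class relation $\vartriangleleft$ is well-founded in a model if every nonempty set of the model contained in its field has a $\vartriangleleft$-minimal element.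
   Formalization: The inclusion M ⊆ N is taken to mean also that each set of M has the same members in N as in M (automatic for transitive models); for mere substructures the claim is false, since ordered pairs of M may be different pairs in N. *)

theory Defs
  imports Main
begin

text \<open>
  A second-order structure \<open>\<langle>M, \<X>\<rangle>\<close> is given by a set \<open>M\<close> (its sets), a relation \<open>E\<close> (the
  membership relation between its sets; only its restriction to \<open>M\<close> matters, so that
  ill-founded models are included) and a family \<open>X\<close> of subsets of \<open>M\<close> (its classes).
  Membership of a set in a class is true membership.
\<close>

definition ext_of :: "'a set \<Rightarrow> ('a \<Rightarrow> 'a \<Rightarrow> bool) \<Rightarrow> 'a \<Rightarrow> 'a set" where
  "ext_of M E a = {x \<in> M. E x a}"

subsection \<open>First-order formulas with class parameters\<close>

text \<open>
  Set variables and class variables are separate sorts, each named by natural numbers.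
  There are no class quantifiers.
\<close>

datatype fm =
    FEq nat nat       \<comment> \<open>equality of two set variables\<close>
  | FMem nat nat      \<comment> \<open>membership of a set variable in a set variable\<close>
  | FIn nat nat       \<comment> \<open>membership of a set variable in a class variable\<close>
  | FNeg fm
  | FConj fm fm
  | FAll nat fm       \<comment> \<open>quantification over sets\<close>

primrec sat ::
  "'a set \<Rightarrow> ('a \<Rightarrow> 'a \<Rightarrow> bool) \<Rightarrow> fm \<Rightarrow> (nat \<Rightarrow> 'a) \<Rightarrow> (nat \<Rightarrow> 'a set) \<Rightarrow> bool" where
  "sat M E (FEq i j) s C \<longleftrightarrow> s i = s j"
| "sat M E (FMem i j) s C \<longleftrightarrow> E (s i) (s j)"
| "sat M E (FIn i k) s C \<longleftrightarrow> s i \<in> C k"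
| "sat M E (FNeg \<phi>) s C \<longleftrightarrow> \<not> sat M E \<phi> s C"
| "sat M E (FConj \<phi> \<psi>) s C \<longleftrightarrow> sat M E \<phi> s C \<and> sat M E \<psi> s C"
| "sat M E (FAll i \<phi>) s C \<longleftrightarrow> (\<forall>x\<in>M. sat M E \<phi> (s(i := x)) C)"

subsection \<open>Pairs, relations, functions and ordinals of a model\<close>

definition is_upair :: "'a set \<Rightarrow> ('a \<Rightarrow> 'a \<Rightarrow> bool) \<Rightarrow> 'a \<Rightarrow> 'a \<Rightarrow> 'a \<Rightarrow> bool" where
  "is_upair M E c a b \<longleftrightarrow> c \<in> M \<and> a \<in> M \<and> b \<in> M \<and> ext_of M E c = {a, b}"

text \<open>Kuratowski pairs: \<open>p = {{a}, {a, b}}\<close>.\<close>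

definition is_opair :: "'a set \<Rightarrow> ('a \<Rightarrow> 'a \<Rightarrow> bool) \<Rightarrow> 'a \<Rightarrow> 'a \<Rightarrow> 'a \<Rightarrow> bool" where
  "is_opair M E p a b \<longleftrightarrow>
     (\<exists>u v. is_upair M E u a a \<and> is_upair M E v a b \<and> is_upair M E p u v)"

definition is_relation :: "'a set \<Rightarrow> ('a \<Rightarrow> 'a \<Rightarrow> bool) \<Rightarrow> 'a set \<Rightarrow> bool" where
  "is_relation M E R \<longleftrightarrow> (\<forall>p\<in>R. \<exists>a b. is_opair M E p a b)"

definition related :: "'a set \<Rightarrow> ('a \<Rightarrow> 'a \<Rightarrow> bool) \<Rightarrow> 'a set \<Rightarrow> 'a \<Rightarrow> 'a \<Rightarrow> bool" where
  "related M E R a b \<longleftrightarrow> (\<exists>p\<in>R. is_opair M E p a b)"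

definition field_of :: "'a set \<Rightarrow> ('a \<Rightarrow> 'a \<Rightarrow> bool) \<Rightarrow> 'a set \<Rightarrow> 'a set" where
  "field_of M E R = {a \<in> M. \<exists>b\<in>M. related M E R a b \<or> related M E R b a}"

text \<open>Class functions need not be defined on all sets.\<close>

definition is_function :: "'a set \<Rightarrow> ('a \<Rightarrow> 'a \<Rightarrow> bool) \<Rightarrow> 'a set \<Rightarrow> bool" where
  "is_function M E G \<longleftrightarrow> is_relation M E G \<and>
     (\<forall>a b c. related M E G a b \<and> related M E G a c \<longrightarrow> b = c)"

text \<open>An ordinal is a transitive set that is strictly well-ordered by membership.\<close>

definition is_ordinal :: "'a set \<Rightarrow> ('a \<Rightarrow> 'a \<Rightarrow> bool) \<Rightarrow> 'a \<Rightarrow> bool" where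
  "is_ordinal M E a \<longleftrightarrow> a \<in> M \<and>
     (\<forall>x \<in> ext_of M E a. ext_of M E x \<subseteq> ext_of M E a) \<and>
     (\<forall>x \<in> ext_of M E a. \<not> E x x) \<and>
     (\<forall>x \<in> ext_of M E a. \<forall>y \<in> ext_of M E a. \<forall>z \<in> ext_of M E a. E x y \<and> E y z \<longrightarrow> E x z) \<and>
     (\<forall>x \<in> ext_of M E a. \<forall>y \<in> ext_of M E a. E x y \<or> x = y \<or> E y x) \<and>
     (\<forall>b \<in> M. ext_of M E b \<noteq> {} \<and> ext_of M E b \<subseteq> ext_of M E a \<longrightarrow>
        (\<exists>m \<in> ext_of M E b. \<forall>x \<in> ext_of M E b. x = m \<or> E m x))"

definition ordinals :: "'a set \<Rightarrow> ('a \<Rightarrow> 'a \<Rightarrow> bool) \<Rightarrow> 'a set" where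
  "ordinals M E = {a. is_ordinal M E a}"

subsection \<open>Goedel-Bernays set theory without power set, with global choice\<close>

text \<open>
  Extensionality for classes is automatic, since classes are subsets of \<open>M\<close>. Separation for
  sets is an instance of replacement, because class functions may be partial, and every set is
  coextensive with a class by comprehension.
\<close>

definition GBC_minus :: "'a set \<Rightarrow> ('a \<Rightarrow> 'a \<Rightarrow> bool) \<Rightarrow> 'a set set \<Rightarrow> bool" where
  "GBC_minus M E X \<longleftrightarrow>
     X \<subseteq> Pow M \<and>
     \<comment> \<open>extensionality\<close>
     (\<forall>a\<in>M. \<forall>b\<in>M. ext_of M E a = ext_of M E b \<longrightarrow> a = b) \<and>
     \<comment> \<open>pairing\<close>
     (\<forall>a\<in>M. \<forall>b\<in>M. \<exists>c\<in>M. ext_of M E c = {a, b}) \<and>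
     \<comment> \<open>union\<close>
     (\<forall>a\<in>M. \<exists>u\<in>M. ext_of M E u = (\<Union>x \<in> ext_of M E a. ext_of M E x)) \<and>
     \<comment> \<open>infinity\<close>
     (\<exists>w\<in>M. (\<exists>z \<in> ext_of M E w. ext_of M E z = {}) \<and>
        (\<forall>x \<in> ext_of M E w. \<exists>y \<in> ext_of M E w. ext_of M E y = insert x (ext_of M E x))) \<and>
     \<comment> \<open>foundation\<close>
     (\<forall>a\<in>M. ext_of M E a \<noteq> {} \<longrightarrow>
        (\<exists>m \<in> ext_of M E a. ext_of M E m \<inter> ext_of M E a = {})) \<and>
     \<comment> \<open>first-order class comprehension, with set and class parameters\<close>
     (\<forall>\<phi> i s C. range s \<subseteq> M \<and> range C \<subseteq> X \<longrightarrow>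
        {x \<in> M. sat M E \<phi> (s(i := x)) C} \<in> X) \<and>
     \<comment> \<open>class replacement\<close>
     (\<forall>G\<in>X. is_function M E G \<longrightarrow>
        (\<forall>a\<in>M. \<exists>b\<in>M. ext_of M E b = {y \<in> M. \<exists>x \<in> ext_of M E a. related M E G x y})) \<and>
     \<comment> \<open>global choice: a class bijection between the universe and the ordinals\<close>
     (\<exists>f. bij_betw f M (ordinals M E) \<and>
        {p \<in> M. \<exists>x\<in>M. is_opair M E p x (f x)} \<in> X)"

subsection \<open>Well-foundedness in a model\<close>

definition well_founded_in :: "'a set \<Rightarrow> ('a \<Rightarrow> 'a \<Rightarrow> bool) \<Rightarrow> 'a set \<Rightarrow> bool" where
  "well_founded_in M E R \<longleftrightarrow>
     (\<forall>a\<in>M. ext_of M E a \<noteq> {} \<and> ext_of M E a \<subseteq> field_of M E R \<longrightarrow>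
        (\<exists>m \<in> ext_of M E a. \<not> (\<exists>x \<in> ext_of M E a. related M E R x m)))"

subsection \<open>Inclusion of models\<close>

text \<open>
  Sets count among the classes, and a class has the same members in both models (classes are
  literally sets of members). So inclusion \<open>M \<subseteq> N\<close> means that a set of the smaller model
  has the same members in both. This is automatic for transitive models with true membership.
  For arbitrary models it says that \<open>N\<close> is an end-extension of \<open>M\<close>; for mere substructures
  even the ordered pairs of \<open>M\<close> could fail to be the corresponding pairs of \<open>N\<close>.
\<close>

definition submodel ::
  "'a set \<Rightarrow> ('a \<Rightarrow> 'a \<Rightarrow> bool) \<Rightarrow> 'a set set \<Rightarrow>
   'a set \<Rightarrow> ('a \<Rightarrow> 'a \<Rightarrow> bool) \<Rightarrow> 'a set set \<Rightarrow> bool" where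
  "submodel M E X N F Y \<longleftrightarrow>
     M \<subseteq> N \<and> X \<subseteq> Y \<and> (\<forall>a\<in>M. ext_of M E a = ext_of N F a)"

end

theory Submission
  imports Defs
begin

text \<open>
  Downward absoluteness is immediate. For the converse, let \<open>b\<close> be a set of the larger model
  contained in the field of the relation. Global choice of the smaller model sends \<open>b\<close> to a set of
  ordinals, which is bounded by an ordinal; since the ordinals are shared, \<open>b\<close> is covered by a
  set \<open>A\<close> of the smaller model. There the relation, being well-founded on \<open>A\<close>, has a Mostowski
  collapse on \<open>A\<close>, and an element of \<open>b\<close> with \<open>\<in>\<close>-minimal collapse is minimal in \<open>b\<close>.
\<close>

section \<open>Renaming of variables in formulas\<close>

text \<open>\<open>f\<close> acts on bound variables as well as free ones, so the renaming avoids
  capture only when \<open>f\<close> is injective. Class variables are never bound.\<close>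

primrec ren :: "(nat \<Rightarrow> nat) \<Rightarrow> (nat \<Rightarrow> nat) \<Rightarrow> fm \<Rightarrow> fm" where
  "ren f g (FEq i j) = FEq (f i) (f j)"
| "ren f g (FMem i j) = FMem (f i) (f j)"
| "ren f g (FIn i k) = FIn (f i) (g k)"
| "ren f g (FNeg \<phi>) = FNeg (ren f g \<phi>)"
| "ren f g (FConj \<phi> \<psi>) = FConj (ren f g \<phi>) (ren f g \<psi>)"
| "ren f g (FAll i \<phi>) = FAll (f i) (ren f g \<phi>)"

text \<open>Every set variable counts, bound ones included: a crude bound beyond which the
  assignment does not affect satisfaction.\<close>

primrec max_var :: "fm \<Rightarrow> nat" where
  "max_var (FEq i j) = max i j"
| "max_var (FMem i j) = max i j"
| "max_var (FIn i k) = i"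
| "max_var (FNeg \<phi>) = max_var \<phi>"
| "max_var (FConj \<phi> \<psi>) = max (max_var \<phi>) (max_var \<psi>)"
| "max_var (FAll i \<phi>) = max i (max_var \<phi>)"

text \<open>By injectivity, updating the assignment at \<open>f i\<close> changes
  \<open>s \<circ> f\<close> only at \<open>i\<close>; this settles the quantifier case.\<close>

lemma sat_ren:
  assumes "inj f"
  shows "sat M E (ren f g \<phi>) s C \<longleftrightarrow> sat M E \<phi> (s \<circ> f) (C \<circ> g)"
proof (induction \<phi> arbitrary: s)
  case (FAll i \<phi>)
  have "s(f i := x) \<circ> f = (s \<circ> f)(i := x)" for x
    using assms by (auto simp: fun_eq_iff inj_eq)
  then show ?case by (simp only: ren.simps sat.simps FAll)
qed auto

lemma sat_cong:
  "(\<And>i. i \<le> max_var \<phi> \<Longrightarrow> s i = t i) \<Longrightarrow> sat M E \<phi> s C \<longleftrightarrow> sat M E \<phi> t C"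
proof (induction \<phi> arbitrary: s t)
  case (FNeg \<phi>)
  have "sat M E \<phi> s C \<longleftrightarrow> sat M E \<phi> t C"
    by (rule FNeg.IH) (simp add: FNeg.prems)
  then show ?case by simp
next
  case (FConj \<phi> \<psi>)
  have "sat M E \<phi> s C \<longleftrightarrow> sat M E \<phi> t C" "sat M E \<psi> s C \<longleftrightarrow> sat M E \<psi> t C"
    by (rule FConj.IH, simp add: FConj.prems)+
  then show ?case by simp
next
  case (FAll i \<phi>)
  have "sat M E \<phi> (s(i := x)) C \<longleftrightarrow> sat M E \<phi> (t(i := x)) C" for x
    by (rule FAll.IH) (simp add: FAll.prems)
  then show ?case by simp
qed auto

section \<open>Definable predicates\<close>

locale gbc =
  fixes M :: "'a set" and E :: "'a \<Rightarrow> 'a \<Rightarrow> bool" and X :: "'a set set"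
  assumes GBC: "GBC_minus M E X"
begin

abbreviation ext where "ext \<equiv> ext_of M E"

text \<open>Definability is semantic, so formulas never have to be written out. Only class
  parameters occur; a set parameter \<open>a\<close> enters through the class
  \<open>{a}\<close>.\<close>

definition definable :: "((nat \<Rightarrow> 'a) \<Rightarrow> bool) \<Rightarrow> bool" where
  "definable P \<longleftrightarrow> (\<exists>\<phi> C. range C \<subseteq> X \<and>
     (\<forall>s. range s \<subseteq> M \<longrightarrow> (P s \<longleftrightarrow> sat M E \<phi> s C)))"

text \<open>A variable or a set parameter. The atomic rules are stated for both at once, so that
  backward application handles either.\<close>

definition trm :: "((nat \<Rightarrow> 'a) \<Rightarrow> 'a) \<Rightarrow> bool" where
  "trm t \<longleftrightarrow> (\<exists>i. t = (\<lambda>s. s i)) \<or> (\<exists>a\<in>M. t = (\<lambda>s. a))"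

section \<open>The axioms as separate facts\<close>

lemmas GBC_conjuncts = GBC[unfolded GBC_minus_def]

lemma class_subset: "A \<in> X \<Longrightarrow> A \<subseteq> M"
  using GBC_conjuncts[THEN conjunct1] by blast

lemma ext_subset: "ext a \<subseteq> M"
  by (auto simp: ext_of_def)

lemma extensionality: "a \<in> M \<Longrightarrow> b \<in> M \<Longrightarrow> ext a = ext b \<Longrightarrow> a = b"
  by (rule GBC_conjuncts[THEN conjunct2, THEN conjunct1, rule_format])

lemma pairing: "a \<in> M \<Longrightarrow> b \<in> M \<Longrightarrow> \<exists>c\<in>M. ext c = {a, b}"
  by (rule GBC_conjuncts[THEN conjunct2, THEN conjunct2, THEN conjunct1, rule_format])

lemma union: "a \<in> M \<Longrightarrow> \<exists>u\<in>M. ext u = (\<Union>x \<in> ext a. ext x)"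
  by (rule GBC_conjuncts[THEN conjunct2, THEN conjunct2, THEN conjunct2, THEN conjunct1, rule_format])

lemma foundation:
  "a \<in> M \<Longrightarrow> ext a \<noteq> {} \<Longrightarrow> \<exists>m \<in> ext a. ext m \<inter> ext a = {}"
  by (rule GBC_conjuncts[THEN conjunct2, THEN conjunct2, THEN conjunct2, THEN conjunct2,
      THEN conjunct2, THEN conjunct1, rule_format])

lemma raw_comprehension:
  "range s \<subseteq> M \<Longrightarrow> range C \<subseteq> X \<Longrightarrow> {x \<in> M. sat M E \<phi> (s(i := x)) C} \<in> X"
  by (rule GBC_conjuncts[THEN conjunct2, THEN conjunct2, THEN conjunct2, THEN conjunct2,
      THEN conjunct2, THEN conjunct2, THEN conjunct1, rule_format]) simp

lemma raw_replacement:
  "G \<in> X \<Longrightarrow> is_function M E G \<Longrightarrow> a \<in> M \<Longrightarrow>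
     \<exists>b\<in>M. ext b = {y \<in> M. \<exists>x \<in> ext a. related M E G x y}"
  by (rule GBC_conjuncts[THEN conjunct2, THEN conjunct2, THEN conjunct2, THEN conjunct2,
      THEN conjunct2, THEN conjunct2, THEN conjunct2, THEN conjunct1, rule_format])

lemma global_choice:
  "\<exists>f. bij_betw f M (ordinals M E) \<and> {p \<in> M. \<exists>x\<in>M. is_opair M E p x (f x)} \<in> X"
  by (rule GBC_conjuncts[THEN conjunct2, THEN conjunct2, THEN conjunct2, THEN conjunct2,
      THEN conjunct2, THEN conjunct2, THEN conjunct2, THEN conjunct2])

lemma sets_nonempty: "M \<noteq> {}"
  using GBC_conjuncts[THEN conjunct2, THEN conjunct2, THEN conjunct2, THEN conjunct2,
      THEN conjunct1] by blast

lemma classes_nonempty: "X \<noteq> {}"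
  using global_choice by blast

section \<open>Closure of definability under connectives and quantifiers\<close>

lemma definable_cong:
  assumes "definable Q" and "\<And>s. range s \<subseteq> M \<Longrightarrow> P s \<longleftrightarrow> Q s"
  shows "definable P"
  using assms(1) unfolding definable_def by (simp add: assms(2) cong: imp_cong)

lemma definableI:
  assumes "\<And>s C. range s \<subseteq> M \<Longrightarrow> P s \<longleftrightarrow> sat M E \<phi> s C"
  shows "definable P"
proof -
  \<comment> \<open>An arbitrary class serves as default value for all class variables; satisfaction
    of \<open>\<phi>\<close> is assumed to agree with \<open>P\<close> for every
    \<open>C\<close>.\<close>
  obtain A where "A \<in> X" using classes_nonempty by blast
  then show ?thesis unfolding definable_def using assms
    by (intro exI[of _ \<phi>] exI[of _ "\<lambda>_. A"]) auto
qed

lemma definable_not: "definable P \<Longrightarrow> definable (\<lambda>s. \<not> P s)"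
proof -
  assume "definable P"
  then obtain \<phi> C where "range C \<subseteq> X" "\<And>s. range s \<subseteq> M \<Longrightarrow> P s \<longleftrightarrow> sat M E \<phi> s C"
    unfolding definable_def by blast
  then show ?thesis unfolding definable_def
    by (intro exI[of _ "FNeg \<phi>"] exI[of _ C]) simp
qed

text \<open>The class parameters of the two formulas are interleaved.\<close>

lemma definable_conj:
  assumes "definable P" "definable Q"
  shows "definable (\<lambda>s. P s \<and> Q s)"
proof -
  obtain \<phi> C where \<phi>: "range C \<subseteq> X" "\<And>s. range s \<subseteq> M \<Longrightarrow> P s \<longleftrightarrow> sat M E \<phi> s C"
    using assms(1) unfolding definable_def by blast
  obtain \<psi> D where \<psi>: "range D \<subseteq> X" "\<And>s. range s \<subseteq> M \<Longrightarrow> Q s \<longleftrightarrow> sat M E \<psi> s D"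
    using assms(2) unfolding definable_def by blast
  define B where "B n = (if even n then C (n div 2) else D (n div 2))" for n
  have B: "B \<circ> (\<lambda>n. 2 * n) = C" "B \<circ> (\<lambda>n. 2 * n + 1) = D"
    by (auto simp: B_def)
  show ?thesis unfolding definable_def
  proof (intro exI conjI allI impI)
    show "range B \<subseteq> X" using \<phi>(1) \<psi>(1) by (auto simp: B_def)
  next
    fix s :: "nat \<Rightarrow> 'a" assume "range s \<subseteq> M"
    then show "P s \<and> Q s \<longleftrightarrow>
        sat M E (FConj (ren id (\<lambda>n. 2 * n) \<phi>) (ren id (\<lambda>n. 2 * n + 1) \<psi>)) s B"
      using \<phi>(2) \<psi>(2) by (simp add: sat_ren B del: One_nat_def add_Suc_right)
  qed
qed

text \<open>
  Quantification in de Bruijn style: the quantified variable becomes variable 0 and the others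
  are shifted, so that applying the rule backwards never captures a variable.
\<close>

lemma definable_all:
  assumes "definable (\<lambda>s. Q (\<lambda>i. s (Suc i)) (s 0))"
  shows "definable (\<lambda>s. \<forall>x\<in>M. Q s x)"
proof -
  obtain \<phi> C where \<phi>: "range C \<subseteq> X"
    "\<And>s. range s \<subseteq> M \<Longrightarrow> Q (\<lambda>i. s (Suc i)) (s 0) \<longleftrightarrow> sat M E \<phi> s C"
    using assms unfolding definable_def by blast
  define n where "n = max_var \<phi>"
  \<comment> \<open>A cyclic permutation of \<open>0..n\<close> that turns de Bruijn numbering back
    into named variables: the quantified variable 0 becomes \<open>n\<close> and \<open>1..n\<close>
    move down by one. Above \<open>n\<close> it is the identity, which is harmless because
    \<open>\<phi>\<close> mentions no variable there.\<close>
  define f where "f i = (if i = 0 then n else if i \<le> n then i - 1 else i)" for i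
  have "inj f" by (rule injI) (auto simp: f_def split: if_splits)
  have eq: "Q s x \<longleftrightarrow> sat M E (ren f id \<phi>) (s(n := x)) C" if "range s \<subseteq> M" "x \<in> M" for s x
  proof -
    have "range (case_nat x s) \<subseteq> M"
      using that by (auto simp: image_subset_iff split: nat.split)
    then have "Q s x \<longleftrightarrow> sat M E \<phi> (case_nat x s) C"
      using \<phi>(2)[of "case_nat x s"] by simp
    also have "\<dots> \<longleftrightarrow> sat M E \<phi> (s(n := x) \<circ> f) C"
      by (rule sat_cong) (auto simp: f_def n_def split: nat.split)
    finally show ?thesis by (simp add: sat_ren[OF \<open>inj f\<close>])
  qed
  show ?thesis unfolding definable_def
    using \<phi>(1) eq by (intro exI[of _ "FAll n (ren f id \<phi>)"] exI[of _ C]) auto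
qed

lemma definable_disj: "definable P \<Longrightarrow> definable Q \<Longrightarrow> definable (\<lambda>s. P s \<or> Q s)"
  using definable_not[OF definable_conj[OF definable_not definable_not]] by simp

lemma definable_imp: "definable P \<Longrightarrow> definable Q \<Longrightarrow> definable (\<lambda>s. P s \<longrightarrow> Q s)"
  unfolding imp_conv_disj by (intro definable_disj definable_not)

lemma definable_iff: "definable P \<Longrightarrow> definable Q \<Longrightarrow> definable (\<lambda>s. P s \<longleftrightarrow> Q s)"
  unfolding iff_conv_conj_imp by (intro definable_conj definable_imp)

lemma definable_ex:
  assumes "definable (\<lambda>s. Q (\<lambda>i. s (Suc i)) (s 0))"
  shows "definable (\<lambda>s. \<exists>x\<in>M. Q s x)"
  using definable_not[OF definable_all[of "\<lambda>s x. \<not> Q s x", OF definable_not[OF assms]]]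
  by simp

lemma definable_const: "definable (\<lambda>s. b)"
proof (cases b)
  case True
  then show ?thesis by (intro definableI[of _ "FEq 0 0"]) simp
next
  case False
  then show ?thesis by (intro definableI[of _ "FNeg (FEq 0 0)"]) simp
qed

section \<open>Terms and atomic formulas\<close>

lemma trm_var: "trm (\<lambda>s. s i)"
  by (auto simp: trm_def)

lemma trm_const: "a \<in> M \<Longrightarrow> trm (\<lambda>s. a)"
  by (auto simp: trm_def)

text \<open>Each quantifier rule shifts the assignment; this discharges the side conditions that
  arise underneath.\<close>

lemma trm_subst: "trm t \<Longrightarrow> trm (\<lambda>s. t (\<lambda>i. s (f i)))"
  by (auto simp: trm_def)

lemma trm_in: "trm t \<Longrightarrow> range s \<subseteq> M \<Longrightarrow> t s \<in> M"
  by (auto simp: trm_def)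

lemma definable_in:
  assumes "trm t" "A \<in> X"
  shows "definable (\<lambda>s. t s \<in> A)"
proof -
  have "definable (\<lambda>s. s i \<in> A)" for i
    unfolding definable_def using assms(2)
    by (intro exI[of _ "FIn i 0"] exI[of _ "\<lambda>_. A"]) auto
  then show ?thesis using assms(1) by (auto simp: trm_def definable_const)
qed

lemma singleton_class: "a \<in> M \<Longrightarrow> {a} \<in> X"
proof -
  assume a: "a \<in> M"
  obtain A where "A \<in> X" using classes_nonempty by blast
  then have "{x \<in> M. sat M E (FEq 0 1) ((\<lambda>_. a)(0 := x)) (\<lambda>_. A)} \<in> X"
    using a by (intro raw_comprehension) auto
  moreover have "{x \<in> M. sat M E (FEq 0 1) ((\<lambda>_. a)(0 := x)) (\<lambda>_. A)} = {a}"
    using a by auto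
  ultimately show ?thesis by simp
qed

lemma definable_eq_const: "a \<in> M \<Longrightarrow> definable (\<lambda>s. s i = a)"
  using definable_in[OF trm_var singleton_class, of a i] by simp

lemma definable_eq:
  assumes "trm t" "trm u"
  shows "definable (\<lambda>s. t s = u s)"
proof -
  have "definable (\<lambda>s. s i = s j)" for i j
    by (rule definableI[of _ "FEq i j"]) simp
  moreover have "definable (\<lambda>s. a = s i)" if "a \<in> M" for a i
    using definable_eq_const[OF that, of i] by (simp add: eq_commute)
  ultimately show ?thesis using assms
    by (auto simp: trm_def definable_const definable_eq_const)
qed

lemma definable_mem:
  assumes "trm t" "trm u"
  shows "definable (\<lambda>s. E (t s) (u s))"
proof -
  have vv: "definable (\<lambda>s. E (s i) (s j))" for i j
    by (rule definableI[of _ "FMem i j"]) simp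
  \<comment> \<open>The language has no names for sets, so the parameter is replaced by a quantified
    variable pinned to it by the class \<open>{a}\<close>.\<close>
  have "definable (\<lambda>s. E (s i) a)" if "a \<in> M" for i a
    using that by (intro definable_cong[where P = "\<lambda>s. E (s i) a", OF
        definable_ex[where Q = "\<lambda>s x. x = a \<and> E (s i) x", OF
        definable_conj[OF definable_eq_const vv]]]) auto
  moreover have "definable (\<lambda>s. E a (s i))" if "a \<in> M" for i a
    using that by (intro definable_cong[where P = "\<lambda>s. E a (s i)", OF
        definable_ex[where Q = "\<lambda>s x. x = a \<and> E x (s i)", OF
        definable_conj[OF definable_eq_const vv]]]) auto
  ultimately show ?thesis using assms vv by (auto simp: trm_def definable_const)
qed

lemmas definable_intros =
  definable_all definable_ex definable_conj definable_disj definable_not definable_imp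
  definable_iff definable_in definable_eq definable_mem trm_var trm_const

lemma comprehension:
  assumes "definable (\<lambda>s. P (s 0))"
  shows "{x \<in> M. P x} \<in> X"
proof -
  obtain \<phi> C where \<phi>: "range C \<subseteq> X"
    "\<And>s. range s \<subseteq> M \<Longrightarrow> P (s 0) \<longleftrightarrow> sat M E \<phi> s C"
    using assms unfolding definable_def by blast
  \<comment> \<open>A default value for the variables other than 0, on which \<open>P\<close> does
    not depend.\<close>
  obtain a where a: "a \<in> M" using sets_nonempty by blast
  have "{x \<in> M. sat M E \<phi> ((\<lambda>_. a)(0 := x)) C} \<in> X"
    using a \<phi>(1) by (intro raw_comprehension) auto
  also have "{x \<in> M. sat M E \<phi> ((\<lambda>_. a)(0 := x)) C} = {x \<in> M. P x}"
  proof -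
    have "sat M E \<phi> ((\<lambda>_. a)(0 := x)) C \<longleftrightarrow> P x" if "x \<in> M" for x
      using \<phi>(2)[of "(\<lambda>_. a)(0 := x)"] that a by auto
    then show ?thesis by blast
  qed
  finally show ?thesis .
qed

lemma ext_class: "a \<in> M \<Longrightarrow> ext a \<in> X"
  unfolding ext_of_def by (intro comprehension definable_intros)

lemma definable_upair:
  assumes "trm t" "trm u" "trm v"
  shows "definable (\<lambda>s. is_upair M E (t s) (u s) (v s))"
proof (rule definable_cong)
  show "definable (\<lambda>s. \<forall>x\<in>M. E x (t s) \<longleftrightarrow> x = u s \<or> x = v s)"
    by (intro definable_intros assms[THEN trm_subst])
next
  fix s :: "nat \<Rightarrow> 'a" assume "range s \<subseteq> M"
  then show "is_upair M E (t s) (u s) (v s) \<longleftrightarrow> (\<forall>x\<in>M. E x (t s) \<longleftrightarrow> x = u s \<or> x = v s)"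
    using assms[THEN trm_in, of s] by (auto simp: is_upair_def ext_of_def)
qed

lemma definable_opair:
  assumes "trm t" "trm u" "trm v"
  shows "definable (\<lambda>s. is_opair M E (t s) (u s) (v s))"
proof (rule definable_cong)
  show "definable (\<lambda>s. \<exists>x\<in>M. \<exists>y\<in>M. is_upair M E x (u s) (u s) \<and>
      is_upair M E y (u s) (v s) \<and> is_upair M E (t s) x y)"
    by (intro definable_intros definable_upair assms[THEN trm_subst])
qed (auto simp: is_opair_def is_upair_def)

lemma definable_related:
  assumes "R \<in> X" "trm t" "trm u"
  shows "definable (\<lambda>s. related M E R (t s) (u s))"
proof (rule definable_cong)
  show "definable (\<lambda>s. \<exists>p\<in>M. p \<in> R \<and> is_opair M E p (t s) (u s))"
    by (intro definable_intros definable_opair assms assms(2,3)[THEN trm_subst])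
qed (use class_subset[OF assms(1)] in \<open>auto simp: related_def\<close>)

text \<open>Here the relation is a set that may itself be a quantified variable, as with the
  attempts quantified over in \<open>collapse\<close>.\<close>

lemma definable_related_ext:
  assumes "trm g" "trm t" "trm u"
  shows "definable (\<lambda>s. related M E (ext (g s)) (t s) (u s))"
proof (rule definable_cong)
  show "definable (\<lambda>s. \<exists>p\<in>M. E p (g s) \<and> is_opair M E p (t s) (u s))"
    by (intro definable_intros definable_opair assms[THEN trm_subst])
qed (auto simp: related_def ext_of_def)

lemmas definable_rules =
  definable_intros definable_opair definable_related definable_related_ext ext_class

section \<open>Set theory inside a model\<close>

lemma opair_in: "is_opair M E p a b \<Longrightarrow> p \<in> M \<and> a \<in> M \<and> b \<in> M"
  by (auto simp: is_opair_def is_upair_def)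

lemma related_in: "related M E R a b \<Longrightarrow> a \<in> M \<and> b \<in> M"
  by (auto simp: related_def dest: opair_in)

lemma opair_exists:
  assumes "a \<in> M" "b \<in> M"
  shows "\<exists>p\<in>M. is_opair M E p a b"
proof -
  obtain u where u: "u \<in> M" "ext u = {a, a}" using pairing[OF assms(1,1)] ..
  obtain v where v: "v \<in> M" "ext v = {a, b}" using pairing[OF assms] ..
  obtain p where p: "p \<in> M" "ext p = {u, v}" using pairing[OF u(1) v(1)] ..
  have "is_upair M E u a a" "is_upair M E v a b" "is_upair M E p u v"
    using u v p assms by (simp_all add: is_upair_def)
  then show ?thesis unfolding is_opair_def using p(1) by blast
qed

lemma opair_unique: "is_opair M E p a b \<Longrightarrow> is_opair M E q a b \<Longrightarrow> p = q"
  unfolding is_opair_def is_upair_def using extensionality by metis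

text \<open>Taking \<open>ext\<close> of the members of \<open>p\<close> yields the genuine
  Kuratowski pair of \<open>a\<close> and \<open>b\<close>, to which the usual argument
  applies.\<close>

lemma opair_inject:
  assumes "is_opair M E p a b" "is_opair M E p c d"
  shows "a = c \<and> b = d"
proof -
  obtain u v where uv: "ext u = {a}" "ext v = {a, b}" "ext p = {u, v}"
    using assms(1) by (auto simp: is_opair_def is_upair_def)
  obtain x y where xy: "ext x = {c}" "ext y = {c, d}" "ext p = {x, y}"
    using assms(2) by (auto simp: is_opair_def is_upair_def)
  have "ext ` ext p = {{a}, {a, b}}" using uv by simp
  moreover have "ext ` ext p = {{c}, {c, d}}" unfolding xy(3) using xy by simp
  ultimately have "{{a}, {a, b}} = {{c}, {c, d}}" by simp
  then show ?thesis unfolding doubleton_eq_iff by blast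
qed

text \<open>The definability premise ranges over all terms, so that it can be applied under the
  quantifiers of the comprehension that forms the graph.\<close>

lemma replacement:
  assumes P: "\<And>t u. trm t \<Longrightarrow> trm u \<Longrightarrow> definable (\<lambda>s. P (t s) (u s))" and a: "a \<in> M"
    and functional: "\<And>x y z. x \<in> ext a \<Longrightarrow> P x y \<Longrightarrow> P x z \<Longrightarrow> y \<in> M \<Longrightarrow> z \<in> M \<Longrightarrow> y = z"
  shows "\<exists>b\<in>M. ext b = {y \<in> M. \<exists>x \<in> ext a. P x y}"
proof -
  \<comment> \<open>The graph is cut down to first coordinates in \<open>a\<close>, since
    functionality is assumed only there.\<close>
  define G where "G = {p \<in> M. \<exists>x\<in>M. \<exists>y\<in>M. is_opair M E p x y \<and> E x a \<and> P x y}"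
  have "G \<in> X" unfolding G_def
    by (intro comprehension definable_rules P a)
  have rel: "related M E G x y \<longleftrightarrow> x \<in> ext a \<and> y \<in> M \<and> P x y" for x y
  proof
    assume "related M E G x y"
    then show "x \<in> ext a \<and> y \<in> M \<and> P x y"
      using opair_in opair_inject unfolding related_def G_def ext_of_def by blast
  next
    assume *: "x \<in> ext a \<and> y \<in> M \<and> P x y"
    then obtain p where "p \<in> M" "is_opair M E p x y"
      using opair_exists[of x y] ext_subset by blast
    with * show "related M E G x y"
      unfolding related_def G_def ext_of_def by blast
  qed
  have "is_function M E G"
    unfolding is_function_def is_relation_def rel using functional by (auto simp: G_def)
  moreover have "{y \<in> M. \<exists>x \<in> ext a. related M E G x y} = {y \<in> M. \<exists>x \<in> ext a. P x y}"
    unfolding rel by blast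
  ultimately show ?thesis using raw_replacement[OF \<open>G \<in> X\<close> _ a] by simp
qed

text \<open>Replacement along the partial identity on the sets satisfying \<open>P\<close>.\<close>

lemma separation:
  assumes P: "\<And>t. trm t \<Longrightarrow> definable (\<lambda>s. P (t s))" and a: "a \<in> M"
  shows "\<exists>b\<in>M. ext b = {x \<in> ext a. P x}"
proof -
  have "\<exists>b\<in>M. ext b = {y \<in> M. \<exists>x \<in> ext a. x = y \<and> P x}"
    by (intro replacement definable_rules P a) auto
  moreover have "{y \<in> M. \<exists>x \<in> ext a. x = y \<and> P x} = {x \<in> ext a. P x}"
    using ext_subset by blast
  ultimately show ?thesis by simp
qed

text \<open>The union of \<open>{a, {x}}\<close>. With \<open>x = a\<close> this gives
  successors.\<close>

lemma insert_exists:
  assumes "a \<in> M" "x \<in> M"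
  shows "\<exists>b\<in>M. ext b = insert x (ext a)"
proof -
  obtain y where y: "y \<in> M" "ext y = {x, x}" using pairing[OF assms(2,2)] ..
  obtain c where c: "c \<in> M" "ext c = {a, y}" using pairing[OF assms(1) y(1)] ..
  obtain u where "u \<in> M" "ext u = (\<Union>z \<in> ext c. ext z)" using union[OF c(1)] ..
  then show ?thesis using y c by auto
qed

lemma mem_irrefl: "a \<in> M \<Longrightarrow> \<not> E a a"
proof
  assume a: "a \<in> M" "E a a"
  obtain y where y: "y \<in> M" "ext y = {a, a}" using pairing[OF a(1) a(1)] ..
  then show False using foundation[of y] a by (auto simp: ext_of_def)
qed

subsection \<open>Ordinals\<close>

lemma ordinal_trans: "is_ordinal M E \<alpha> \<Longrightarrow> x \<in> ext \<alpha> \<Longrightarrow> ext x \<subseteq> ext \<alpha>"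
  by (simp add: is_ordinal_def)

text \<open>If \<open>\<gamma>\<close> is not all of \<open>\<alpha>\<close>, the least element
  \<open>m\<close> of the difference has exactly the members of \<open>\<gamma>\<close>.\<close>

lemma transitive_subset_ordinal:
  assumes \<alpha>: "is_ordinal M E \<alpha>" and \<gamma>: "\<gamma> \<in> M" "ext \<gamma> \<subseteq> ext \<alpha>"
    and tr: "\<And>x. x \<in> ext \<gamma> \<Longrightarrow> ext x \<subseteq> ext \<gamma>"
  shows "\<gamma> = \<alpha> \<or> E \<gamma> \<alpha>"
proof (cases "ext \<alpha> \<subseteq> ext \<gamma>")
  case True
  then show ?thesis using \<alpha> \<gamma> extensionality by (auto simp: is_ordinal_def)
next
  case False
  have \<alpha>M: "\<alpha> \<in> M" using \<alpha> by (simp add: is_ordinal_def)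
  have "\<exists>d\<in>M. ext d = {x \<in> ext \<alpha>. \<not> E x \<gamma>}"
    by (intro separation definable_rules \<alpha>M \<gamma>(1))
  then obtain d where d: "d \<in> M" "ext d = {x \<in> ext \<alpha>. \<not> E x \<gamma>}" ..
  then have "ext d \<noteq> {}" using False by (auto simp: ext_of_def)
  with d \<alpha> obtain m where m: "m \<in> ext d" "\<forall>x \<in> ext d. x = m \<or> E m x"
    unfolding is_ordinal_def by (metis (no_types, lifting) mem_Collect_eq subsetI)
  have m\<alpha>: "m \<in> ext \<alpha>" "m \<in> M" "\<not> E m \<gamma>" "E m \<alpha>" using m d by (auto simp: ext_of_def)
  have "ext m = ext \<gamma>"
  proof (intro equalityI subsetI)
    fix y assume y: "y \<in> ext m"
    then have y\<alpha>: "y \<in> ext \<alpha>" using ordinal_trans[OF \<alpha> m\<alpha>(1)] by blast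
    show "y \<in> ext \<gamma>"
    proof (rule ccontr)
      assume "y \<notin> ext \<gamma>"
      then have "y \<in> ext d" using d y\<alpha> by (auto simp: ext_of_def)
      then have "y = m \<or> E m y" using m by blast
      moreover have "E y m" using y by (auto simp: ext_of_def)
      ultimately have "E m m" using \<alpha> m\<alpha>(1) y\<alpha> unfolding is_ordinal_def by blast
      then show False using mem_irrefl m\<alpha> by blast
    qed
  next
    fix y assume y: "y \<in> ext \<gamma>"
    then have "E y m \<or> y = m \<or> E m y" using \<alpha> m\<alpha>(1) \<gamma> unfolding is_ordinal_def by blast
    moreover have "m \<notin> ext y" using tr[OF y] m\<alpha> by (auto simp: ext_of_def)
    ultimately show "y \<in> ext m" using y m\<alpha> by (auto simp: ext_of_def)
  qed
  then show ?thesis using extensionality \<gamma> m\<alpha> by metis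
qed

text \<open>The intersection \<open>\<gamma>\<close> is transitive, so it equals or belongs to each
  of the two ordinals. Belonging to both would give \<open>E \<gamma> \<gamma>\<close>.\<close>

lemma ordinal_linear:
  assumes \<alpha>: "is_ordinal M E \<alpha>" and \<beta>: "is_ordinal M E \<beta>"
  shows "E \<alpha> \<beta> \<or> \<alpha> = \<beta> \<or> E \<beta> \<alpha>"
proof -
  have M: "\<alpha> \<in> M" "\<beta> \<in> M" using \<alpha> \<beta> by (auto simp: is_ordinal_def)
  have "\<exists>\<gamma>\<in>M. ext \<gamma> = {x \<in> ext \<alpha>. E x \<beta>}"
    by (intro separation definable_rules M)
  then obtain \<gamma> where \<gamma>: "\<gamma> \<in> M" "ext \<gamma> = {x \<in> ext \<alpha>. E x \<beta>}" ..
  have sub: "ext \<gamma> \<subseteq> ext \<alpha>" "ext \<gamma> \<subseteq> ext \<beta>" using \<gamma> by (auto simp: ext_of_def)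
  have tr: "ext x \<subseteq> ext \<gamma>" if "x \<in> ext \<gamma>" for x
  proof
    fix y assume "y \<in> ext x"
    then have "y \<in> ext \<alpha>" "y \<in> ext \<beta>"
      using that sub ordinal_trans[OF \<alpha>] ordinal_trans[OF \<beta>] by blast+
    then show "y \<in> ext \<gamma>" using \<gamma> by (auto simp: ext_of_def)
  qed
  have "\<gamma> = \<alpha> \<or> E \<gamma> \<alpha>" "\<gamma> = \<beta> \<or> E \<gamma> \<beta>"
    using transitive_subset_ordinal[OF \<alpha> \<gamma>(1) sub(1) tr]
      transitive_subset_ordinal[OF \<beta> \<gamma>(1) sub(2) tr] by simp_all
  moreover have "\<not> (E \<gamma> \<alpha> \<and> E \<gamma> \<beta>)"
    using mem_irrefl[OF \<gamma>(1)] \<gamma> by (auto simp: ext_of_def)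
  ultimately show ?thesis by blast
qed

lemma ordinal_element:
  assumes \<alpha>: "is_ordinal M E \<alpha>" and x: "x \<in> ext \<alpha>"
  shows "is_ordinal M E x"
proof -
  have sub: "ext x \<subseteq> ext \<alpha>" using ordinal_trans[OF assms] .
  have "ext y \<subseteq> ext x" if y: "y \<in> ext x" for y
  proof
    fix z assume z: "z \<in> ext y"
    then have "z \<in> ext \<alpha>" "y \<in> ext \<alpha>" "E z y" "E y x" "z \<in> M"
      using ordinal_trans[OF \<alpha>, of y] sub y by (auto simp: ext_of_def)
    then have "E z x" using \<alpha> x unfolding is_ordinal_def by blast
    then show "z \<in> ext x" using \<open>z \<in> M\<close> by (simp add: ext_of_def)
  qed
  moreover have "x \<in> M" using x by (simp add: ext_of_def)
  ultimately show ?thesis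
    using \<alpha> sub unfolding is_ordinal_def by (meson order_trans subset_iff)
qed

text \<open>The members of \<open>u\<close> are ordinals, hence comparable; an element of
  \<open>b\<close> that is minimal by foundation is therefore least.\<close>

lemma ordinal_Union:
  assumes c: "\<And>\<alpha>. \<alpha> \<in> ext c \<Longrightarrow> is_ordinal M E \<alpha>"
    and u: "u \<in> M" "ext u = (\<Union>\<alpha> \<in> ext c. ext \<alpha>)"
  shows "is_ordinal M E u"
proof -
  have ord: "is_ordinal M E x" if "x \<in> ext u" for x
    using that u c ordinal_element by blast
  show ?thesis unfolding is_ordinal_def
  proof (intro conjI ballI impI)
    fix x assume "x \<in> ext u"
    then obtain \<alpha> where \<alpha>: "\<alpha> \<in> ext c" "x \<in> ext \<alpha>" using u(2) by blast
    then show "ext x \<subseteq> ext u" using u(2) ordinal_trans[OF c] by blast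
  next
    fix x assume "x \<in> ext u"
    then show "\<not> E x x" using mem_irrefl[of x] by (simp add: ext_of_def)
  next
    fix x y z assume *: "x \<in> ext u" "y \<in> ext u" "z \<in> ext u" "E x y \<and> E y z"
    then have "y \<in> ext z" "x \<in> ext y" by (auto simp: ext_of_def)
    then have "x \<in> ext z" using ordinal_trans[OF ord[OF *(3)]] by blast
    then show "E x z" by (simp add: ext_of_def)
  next
    fix x y assume "x \<in> ext u" "y \<in> ext u"
    then show "E x y \<or> x = y \<or> E y x" using ordinal_linear[OF ord ord] by simp
  next
    fix b assume b: "b \<in> M" "ext b \<noteq> {} \<and> ext b \<subseteq> ext u"
    then obtain m where m: "m \<in> ext b" "ext m \<inter> ext b = {}" using foundation[OF b(1)] by blast
    have "x = m \<or> E m x" if x: "x \<in> ext b" for x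
    proof -
      have "\<not> E x m" using m x by (auto simp: ext_of_def)
      then show ?thesis using ordinal_linear[OF ord ord, of x m] x m b by blast
    qed
    then show "\<exists>m\<in>ext b. \<forall>x\<in>ext b. x = m \<or> E m x" using m by blast
  qed (fact u)
qed

text \<open>The supremum is the bound. It may itself belong to \<open>c\<close>, hence the
  alternative of equality.\<close>

lemma ordinal_bound:
  assumes "c \<in> M" and c: "\<And>\<alpha>. \<alpha> \<in> ext c \<Longrightarrow> is_ordinal M E \<alpha>"
  obtains \<beta> where "is_ordinal M E \<beta>" "\<And>\<alpha>. \<alpha> \<in> ext c \<Longrightarrow> \<alpha> = \<beta> \<or> E \<alpha> \<beta>"
proof -
  obtain u where u: "u \<in> M" "ext u = (\<Union>\<alpha> \<in> ext c. ext \<alpha>)" using union[OF assms(1)] ..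
  have ord: "is_ordinal M E u" using ordinal_Union[OF c u] .
  have "\<alpha> = u \<or> E \<alpha> u" if "\<alpha> \<in> ext c" for \<alpha>
  proof (rule transitive_subset_ordinal[OF ord])
    show "\<alpha> \<in> M" using that ext_subset by blast
    show "ext \<alpha> \<subseteq> ext u" using u that by blast
    show "ext x \<subseteq> ext \<alpha>" if "x \<in> ext \<alpha>" for x
      using ordinal_trans[OF c[OF \<open>\<alpha> \<in> ext c\<close>] that] .
  qed
  then show ?thesis using that ord by blast
qed

subsection \<open>Collapsing a well-founded relation on a set\<close>

text \<open>
  Attempts are approximations to the collapse. They are not required to be functional; two of
  them agree by induction along the relation.
\<close>

definition attempt :: "'a set \<Rightarrow> 'a \<Rightarrow> 'a \<Rightarrow> bool" where
  "attempt R A g \<longleftrightarrow> (\<forall>x\<in>M. \<forall>y\<in>M. related M E (ext g) x y \<longrightarrow>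
     E x A \<and>
     (\<forall>z\<in>M. E z A \<and> related M E R z x \<longrightarrow> (\<exists>w\<in>M. related M E (ext g) z w)) \<and>
     (\<forall>w\<in>M. E w y \<longleftrightarrow> (\<exists>z\<in>M. E z A \<and> related M E R z x \<and> related M E (ext g) z w)))"

definition collapse :: "'a set \<Rightarrow> 'a \<Rightarrow> 'a \<Rightarrow> 'a \<Rightarrow> bool" where
  "collapse R A x y \<longleftrightarrow> (\<exists>g\<in>M. attempt R A g \<and> related M E (ext g) x y)"

context
  fixes R A
  assumes R: "R \<in> X" and A: "A \<in> M"
    and wf: "\<And>a. a \<in> M \<Longrightarrow> ext a \<noteq> {} \<Longrightarrow>
      \<exists>m \<in> ext a. \<forall>x \<in> ext a. \<not> related M E R x m"
begin

abbreviation r where "r \<equiv> related M E R"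

text \<open>Needed because induction and replacement are available only for definable
  predicates.\<close>

lemma definable_collapse:
  assumes "trm t" "trm u"
  shows "definable (\<lambda>s. collapse R A (t s) (u s))"
  unfolding collapse_def attempt_def
  by (intro definable_rules R A assms[THEN trm_subst])

text \<open>Separation makes the counterexamples in \<open>A\<close> a set, and a minimal one
  contradicts \<open>step\<close>.\<close>

lemma wf_induction:
  assumes P: "\<And>t. trm t \<Longrightarrow> definable (\<lambda>s. P (t s))" and x: "x \<in> ext A"
    and step: "\<And>x. x \<in> ext A \<Longrightarrow> (\<And>z. z \<in> ext A \<Longrightarrow> r z x \<Longrightarrow> P z) \<Longrightarrow> P x"
  shows "P x"
proof (rule ccontr)
  assume "\<not> P x"
  have "\<exists>a\<in>M. ext a = {x \<in> ext A. \<not> P x}"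
    by (intro separation definable_not P A)
  then obtain a where a: "a \<in> M" "ext a = {x \<in> ext A. \<not> P x}" ..
  then obtain m where "m \<in> ext a" "\<forall>x \<in> ext a. \<not> r x m"
    using wf[of a] x \<open>\<not> P x\<close> by blast
  then show False using step[of m] a by blast
qed

text \<open>The definition bounds its quantifiers by \<open>M\<close> for the sake of definability;
  dropping the bounds is sound because related objects lie in \<open>M\<close>.\<close>

lemma attempt_iff:
  "attempt R A g \<longleftrightarrow> (\<forall>x y. related M E (ext g) x y \<longrightarrow>
     x \<in> ext A \<and>
     (\<forall>z. z \<in> ext A \<and> r z x \<longrightarrow> (\<exists>w. related M E (ext g) z w)) \<and>
     (\<forall>w. w \<in> ext y \<longleftrightarrow> (\<exists>z. z \<in> ext A \<and> r z x \<and> related M E (ext g) z w)))"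
proof -
  have [simp]: "z \<in> ext a \<longleftrightarrow> z \<in> M \<and> E z a" for z a by (auto simp: ext_of_def)
  show ?thesis unfolding attempt_def using related_in by (simp, blast)
qed

text \<open>The members of a value are the values at predecessors. Both domains are closed under
  predecessors in \<open>A\<close>, so by induction \<open>y\<close> and \<open>y'\<close> have the
  same members. The case \<open>g = h\<close> shows that a single attempt is functional.\<close>

lemma attempt_agree:
  assumes g: "attempt R A g" "g \<in> M" and h: "attempt R A h" "h \<in> M"
    and "related M E (ext g) x y" "related M E (ext h) x y'"
  shows "y = y'"
proof -
  let ?P = "\<lambda>x. \<forall>y\<in>M. \<forall>y'\<in>M. related M E (ext g) x y \<longrightarrow> related M E (ext h) x y' \<longrightarrow> y = y'"
  have "?P x"
  proof (rule wf_induction[where P = ?P])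
    show "definable (\<lambda>s. ?P (t s))" if "trm t" for t
      by (intro definable_rules g h trm_subst[OF that])
    show "x \<in> ext A" using assms unfolding attempt_iff by blast
  next
    fix x assume x: "x \<in> ext A" and IH: "\<And>z. z \<in> ext A \<Longrightarrow> r z x \<Longrightarrow> ?P z"
    show "?P x"
    proof (intro ballI impI)
      fix y y' assume y: "y \<in> M" "y' \<in> M" "related M E (ext g) x y" "related M E (ext h) x y'"
      have "w \<in> ext y \<longleftrightarrow> w \<in> ext y'" for w
        using y(3,4) g(1) h(1) IH related_in unfolding attempt_iff by metis
      then show "y = y'" using extensionality y by blast
    qed
  qed
  then show ?thesis using assms related_in by blast
qed

lemma collapse_fun: "collapse R A x y \<Longrightarrow> collapse R A x y' \<Longrightarrow> y = y'"
  unfolding collapse_def using attempt_agree by blast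

text \<open>Replacement over \<open>A\<close>, sending \<open>x\<close> to the pair of
  \<open>x\<close> and its collapse, gathers the union of all attempts into one set.\<close>

lemma greatest_attempt:
  obtains g where "g \<in> M" "attempt R A g" "\<And>x y. related M E (ext g) x y \<longleftrightarrow> collapse R A x y"
proof -
  let ?P = "\<lambda>x p. \<exists>y\<in>M. is_opair M E p x y \<and> collapse R A x y"
  have "\<exists>g\<in>M. ext g = {p \<in> M. \<exists>x\<in>ext A. ?P x p}"
  proof (rule replacement)
    show "definable (\<lambda>s. ?P (t s) (u s))" if "trm t" "trm u" for t u
      by (intro definable_rules definable_collapse that[THEN trm_subst])
    show "p = q" if "?P x p" "?P x q" for x p q
      using that collapse_fun opair_unique by blast
  qed (rule A)
  then obtain g where g: "g \<in> M" "ext g = {p \<in> M. \<exists>x\<in>ext A. ?P x p}" by blast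
  have dom: "x \<in> ext A" if "collapse R A x y" for x y
    using that unfolding collapse_def attempt_iff by blast
  have rel: "related M E (ext g) x y \<longleftrightarrow> collapse R A x y" for x y
  proof
    assume "related M E (ext g) x y"
    then show "collapse R A x y"
      unfolding g related_def using opair_inject by blast
  next
    assume c: "collapse R A x y"
    then have xy: "x \<in> M" "y \<in> M" unfolding collapse_def using related_in by blast+
    then obtain p where "p \<in> M" "is_opair M E p x y" using opair_exists by blast
    then show "related M E (ext g) x y"
      unfolding g related_def using c xy dom by blast
  qed
  have "attempt R A g" unfolding attempt_iff rel
  proof (intro allI impI)
    fix x y assume c: "collapse R A x y"
    then obtain h where h: "h \<in> M" "attempt R A h" "related M E (ext h) x y"
      unfolding collapse_def by blast
    have hc: "collapse R A z w" if "related M E (ext h) z w" for z w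
      using that h unfolding collapse_def by blast
    \<comment> \<open>The clauses at \<open>x\<close> hold for \<open>h\<close>, and by
      \<open>collapse_fun\<close> the collapse has no values at predecessors of \<open>x\<close>
      other than those of \<open>h\<close>.\<close>
    show "x \<in> ext A \<and> (\<forall>z. z \<in> ext A \<and> r z x \<longrightarrow> (\<exists>w. collapse R A z w)) \<and>
        (\<forall>w. w \<in> ext y \<longleftrightarrow> (\<exists>z. z \<in> ext A \<and> r z x \<and> collapse R A z w))"
      using h(2,3) hc collapse_fun dom[OF c] unfolding attempt_iff by metis
  qed
  then show ?thesis using that g rel by blast
qed

text \<open>If all predecessors of \<open>x\<close> have values but \<open>x\<close> has none, the
  greatest attempt can be extended by a pair at \<open>x\<close>, which is absurd.\<close>

lemma collapse_total:
  assumes "x \<in> ext A"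
  shows "\<exists>y\<in>M. collapse R A x y"
proof -
  let ?P = "\<lambda>x. \<exists>y\<in>M. collapse R A x y"
  show "?P x"
  proof (rule wf_induction[where P = ?P, OF _ assms])
    show "definable (\<lambda>s. ?P (t s))" if "trm t" for t
      by (intro definable_rules definable_collapse trm_subst[OF that])
  next
    fix x assume x: "x \<in> ext A" and IH: "\<And>z. z \<in> ext A \<Longrightarrow> r z x \<Longrightarrow> ?P z"
    show "?P x"
    proof (rule ccontr)
      assume no: "\<not> ?P x"
      obtain g where g: "g \<in> M" "attempt R A g"
        "\<And>x y. related M E (ext g) x y \<longleftrightarrow> collapse R A x y"
        using greatest_attempt by blast
      have gM: "collapse R A z w \<Longrightarrow> z \<in> M \<and> w \<in> M" for z w
        using g(3) related_in by blast
      have xM: "x \<in> M" using x ext_subset by blast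
      \<comment> \<open>The value that the recursion prescribes at \<open>x\<close>.\<close>
      have "\<exists>y\<in>M. ext y = {w \<in> M. \<exists>z\<in>ext A. r z x \<and> collapse R A z w}"
        using collapse_fun
        by (intro replacement definable_rules definable_collapse R A xM) blast+
      then obtain y where y: "y \<in> M" "ext y = {w \<in> M. \<exists>z\<in>ext A. r z x \<and> collapse R A z w}"
        by blast
      obtain p where p: "p \<in> M" "is_opair M E p x y" using opair_exists xM y by blast
      obtain h where h: "h \<in> M" "ext h = insert p (ext g)" using insert_exists g p by blast
      have rel: "related M E (ext h) z w \<longleftrightarrow> z = x \<and> w = y \<or> collapse R A z w" for z w
      proof -
        have "related M E (ext h) z w \<longleftrightarrow> is_opair M E p z w \<or> related M E (ext g) z w"
          unfolding related_def h by blast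
        then show ?thesis using opair_inject p(2) g(3) by blast
      qed
      have x': "\<not> collapse R A x w" for w using no gM by blast
      have "\<not> r x x" using IH[OF x] no by blast
      have "attempt R A h" unfolding attempt_iff
      proof (intro allI impI)
        fix z w assume "related M E (ext h) z w"
        then consider "z = x" "w = y" | "collapse R A z w" using rel by blast
        then show "z \<in> ext A \<and> (\<forall>v. v \<in> ext A \<and> r v z \<longrightarrow> (\<exists>w. related M E (ext h) v w)) \<and>
          (\<forall>u. u \<in> ext w \<longleftrightarrow> (\<exists>v. v \<in> ext A \<and> r v z \<and> related M E (ext h) v u))"
        proof cases
          case 1
          have "u \<in> ext y \<longleftrightarrow> (\<exists>v. v \<in> ext A \<and> r v x \<and> collapse R A v u)" for u
            unfolding y(2) using gM by blast
          then show ?thesis unfolding rel 1 using x IH \<open>\<not> r x x\<close> by blast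
        next
          case 2
          \<comment> \<open>The domain of \<open>g\<close> is closed under predecessors and omits
            \<open>x\<close>, so the new pair does not disturb the clauses at old points.\<close>
          then have "\<not> r x z"
            using g(2) x x' unfolding attempt_iff g(3) by blast
          then show ?thesis using 2 g(2) unfolding attempt_iff g(3) rel by blast
        qed
      qed
      then have "collapse R A x y" unfolding collapse_def using h rel by blast
      then show False using x' by blast
    qed
  qed
qed

text \<open>Only these properties are exported: a set function that is total on \<open>A\<close> and
  carries the relation into membership.\<close>

lemma collapse_exists:
  obtains g where "g \<in> M"
    "\<And>x y y'. related M E (ext g) x y \<Longrightarrow> related M E (ext g) x y' \<Longrightarrow> y = y'"
    "\<And>x. x \<in> ext A \<Longrightarrow> \<exists>y\<in>M. related M E (ext g) x y"
    "\<And>x y z w. related M E (ext g) x y \<Longrightarrow> related M E (ext g) z w \<Longrightarrow> r z x \<Longrightarrow> E w y"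
proof -
  obtain g where g: "g \<in> M" "attempt R A g"
    "\<And>x y. related M E (ext g) x y \<longleftrightarrow> collapse R A x y"
    using greatest_attempt by blast
  have "E w y" if "related M E (ext g) x y" "related M E (ext g) z w" "r z x" for x y z w
  proof -
    have "w \<in> ext y" using that g(2) unfolding attempt_iff by blast
    then show ?thesis by (simp add: ext_of_def)
  qed
  then show ?thesis using that[of g] g collapse_fun collapse_total by metis
qed

end

end

section \<open>The two models\<close>

text \<open>Only \<open>p\<close> is assumed to lie in \<open>M\<close>. The components follow,
  since sets of \<open>M\<close> acquire no new members in \<open>N\<close>.\<close>

lemma opair_absolute:
  assumes "M \<subseteq> N" and ext: "\<And>a. a \<in> M \<Longrightarrow> ext_of M E a = ext_of N F a" and p: "p \<in> M"
  shows "is_opair M E p a b \<longleftrightarrow> is_opair N F p a b"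
proof
  assume "is_opair M E p a b"
  then show "is_opair N F p a b"
    using assms unfolding is_opair_def is_upair_def by (metis subsetD)
next
  have down: "x \<in> M" if "y \<in> M" "x \<in> ext_of N F y" for x y
    using ext[OF that(1)] that(2) by (auto simp: ext_of_def)
  assume "is_opair N F p a b"
  then obtain u v where *: "ext_of N F p = {u, v}" "ext_of N F u = {a, a}" "ext_of N F v = {a, b}"
    unfolding is_opair_def is_upair_def by blast
  moreover have "u \<in> M" "v \<in> M" using down[OF p] * by auto
  moreover have "a \<in> M" "b \<in> M" using down[of v] * \<open>v \<in> M\<close> by auto
  ultimately show "is_opair M E p a b"
    unfolding is_opair_def is_upair_def using ext p by metis
qed

theorem theorem9:
  fixes M N :: "'a set"
    and E F :: "'a \<Rightarrow> 'a \<Rightarrow> bool"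
    and X Y :: "'a set set"
    and R :: "'a set"
  assumes "GBC_minus M E X"
    and "GBC_minus N F Y"
    and "submodel M E X N F Y"
    and "ordinals M E = ordinals N F"
    and "R \<in> X"
    and "is_relation M E R"
  shows "well_founded_in M E R \<longleftrightarrow> well_founded_in N F R"
proof -
  interpret m: gbc M E X by standard (fact assms)
  interpret n: gbc N F Y by standard (fact assms)
  have MN: "M \<subseteq> N" and XY: "X \<subseteq> Y" and ext: "\<And>a. a \<in> M \<Longrightarrow> m.ext a = n.ext a"
    using assms(3) by (auto simp: submodel_def)
  have rel: "related N F S a b \<longleftrightarrow> related M E S a b" if "S \<subseteq> M" for S a b
    using opair_absolute[OF MN ext] that unfolding related_def by blast
  have RM: "R \<subseteq> M" using m.class_subset assms(5) .
  have field: "field_of N F R = field_of M E R"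
    unfolding field_of_def rel[OF RM] using m.related_in MN by blast
  show ?thesis
  proof
    assume wf: "well_founded_in N F R"
    show "well_founded_in M E R" unfolding well_founded_in_def
    proof (intro ballI impI)
      fix a assume "a \<in> M" "m.ext a \<noteq> {} \<and> m.ext a \<subseteq> field_of M E R"
      then show "\<exists>m\<in>m.ext a. \<not> (\<exists>x\<in>m.ext a. related M E R x m)"
        using wf ext[of a] MN unfolding well_founded_in_def field rel[OF RM] by (metis subsetD)
    qed
  next
    assume wf: "well_founded_in M E R"
    \<comment> \<open>A set not contained in the field has a member outside it, and such a member
      has no predecessor at all.\<close>
    have wf': "\<exists>m \<in> m.ext a. \<forall>x \<in> m.ext a. \<not> related M E R x m"
      if a: "a \<in> M" "m.ext a \<noteq> {}" for a
    proof (cases "m.ext a \<subseteq> field_of M E R")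
      case True
      then show ?thesis using wf a unfolding well_founded_in_def by blast
    next
      case False
      then show ?thesis using m.related_in unfolding field_of_def by blast
    qed
    obtain f where f: "bij_betw f M (ordinals M E)"
      and G: "{p \<in> M. \<exists>x\<in>M. is_opair M E p x (f x)} \<in> X"
      using m.global_choice by blast
    define G where "G = {p \<in> M. \<exists>x\<in>M. is_opair M E p x (f x)}"
    have GX: "G \<in> X" using G unfolding G_def .
    have fM: "f x \<in> M" if "x \<in> M" for x
      using bij_betw_apply[OF f that] by (simp add: ordinals_def is_ordinal_def)
    have Grel: "related M E G x y \<longleftrightarrow> x \<in> M \<and> y = f x" for x y
      using m.opair_inject m.opair_exists[OF _ fM] unfolding related_def G_def by blast
    have GM: "G \<subseteq> M" by (auto simp: G_def)
    show "well_founded_in N F R" unfolding well_founded_in_def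
    proof (intro ballI impI)
      fix b assume b: "b \<in> N" "n.ext b \<noteq> {} \<and> n.ext b \<subseteq> field_of N F R"
      then have bM: "n.ext b \<subseteq> M" unfolding field by (auto simp: field_of_def)
      \<comment> \<open>The graph \<open>G\<close> is also a class of the larger model, which can
        therefore form the image of \<open>b\<close>, although \<open>b\<close> need not belong to
        \<open>M\<close>.\<close>
      have "\<exists>c\<in>N. n.ext c = {y \<in> N. \<exists>x\<in>n.ext b. related N F G x y}"
      proof (rule n.replacement)
        show "n.definable (\<lambda>s. related N F G (t s) (u s))" if "n.trm t" "n.trm u" for t u
          using that XY GX by (intro n.definable_rules) blast+
      qed (use b in \<open>auto simp: rel[OF GM] Grel\<close>)
      moreover have "{y \<in> N. \<exists>x\<in>n.ext b. related N F G x y} = f ` n.ext b"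
        unfolding rel[OF GM] Grel using bM fM MN by blast
      ultimately obtain c where c: "c \<in> N" "n.ext c = f ` n.ext b" by auto
      have "is_ordinal N F \<alpha>" if "\<alpha> \<in> n.ext c" for \<alpha>
        using that bM bij_betw_apply[OF f] c assms(4) by (auto simp: ordinals_def)
      then obtain \<beta> where \<beta>: "is_ordinal N F \<beta>" "\<And>\<alpha>. \<alpha> \<in> n.ext c \<Longrightarrow> \<alpha> = \<beta> \<or> F \<alpha> \<beta>"
        using n.ordinal_bound[OF c(1)] by blast
      \<comment> \<open>The bound was found in \<open>N\<close>; having the same ordinals brings it
        into \<open>M\<close>.\<close>
      then have \<beta>M: "\<beta> \<in> M" using assms(4) by (auto simp: ordinals_def is_ordinal_def)
      \<comment> \<open>The successor of \<open>\<beta>\<close> turns the non-strict bound into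
        membership.\<close>
      obtain \<sigma> where \<sigma>: "\<sigma> \<in> M" "m.ext \<sigma> = insert \<beta> (m.ext \<beta>)"
        using m.insert_exists \<beta>M by blast
      \<comment> \<open>Replacement along the inverse of \<open>f\<close>, which is functional
        because \<open>f\<close> is injective, pulls \<open>\<sigma>\<close> back to a cover of
        \<open>b\<close>.\<close>
      have "\<exists>A\<in>M. m.ext A = {x \<in> M. \<exists>\<alpha>\<in>m.ext \<sigma>. related M E G x \<alpha>}"
      proof (rule m.replacement)
        show "m.definable (\<lambda>s. related M E G (u s) (t s))" if "m.trm t" "m.trm u" for t u
          using that GX by (intro m.definable_rules)
      qed (use \<sigma> f in \<open>auto simp: Grel bij_betw_def inj_on_def\<close>)
      then obtain A where A: "A \<in> M" "m.ext A = {x \<in> M. f x \<in> m.ext \<sigma>}"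
        unfolding Grel by auto
      have bA: "n.ext b \<subseteq> m.ext A"
      proof
        fix x assume x: "x \<in> n.ext b"
        then have "f x = \<beta> \<or> F (f x) \<beta>" "f x \<in> N" "x \<in> M" using \<beta> c bM fM MN by blast+
        then show "x \<in> m.ext A" using A \<sigma> ext[OF \<beta>M] by (auto simp: ext_of_def)
      qed
      \<comment> \<open>The collapse is built in \<open>M\<close>, where well-foundedness is known;
        as a set of \<open>N\<close> it has the same pairs.\<close>
      obtain g where g: "g \<in> M"
        "\<And>x y y'. related M E (m.ext g) x y \<Longrightarrow> related M E (m.ext g) x y' \<Longrightarrow> y = y'"
        "\<And>x. x \<in> m.ext A \<Longrightarrow> \<exists>y\<in>M. related M E (m.ext g) x y"
        "\<And>x y z w. related M E (m.ext g) x y \<Longrightarrow> related M E (m.ext g) z w \<Longrightarrow>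
          related M E R z x \<Longrightarrow> E w y"
        using m.collapse_exists[OF assms(5) A(1) wf'] by blast
      have gN: "related N F (n.ext g) x y \<longleftrightarrow> related M E (m.ext g) x y" for x y
        using rel[OF m.ext_subset[of g]] ext[OF g(1)] by simp
      \<comment> \<open>The image of \<open>b\<close> under the collapse is a set of
        \<open>N\<close>, so foundation in \<open>N\<close> applies to it.\<close>
      have "\<exists>d\<in>N. n.ext d = {y \<in> N. \<exists>x\<in>n.ext b. related N F (n.ext g) x y}"
      proof (rule n.replacement)
        show "n.definable (\<lambda>s. related N F (n.ext g) (t s) (u s))" if "n.trm t" "n.trm u" for t u
          using that g(1) MN by (intro n.definable_rules) blast+
        show "y = z" if "related N F (n.ext g) x y" "related N F (n.ext g) x z" for x y z
          using that unfolding gN by (rule g(2))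
      qed (fact b)
      then obtain d where d: "d \<in> N"
        "n.ext d = {y \<in> N. \<exists>x\<in>n.ext b. related M E (m.ext g) x y}"
        unfolding gN ..
      obtain x0 where "x0 \<in> n.ext b" using b by blast
      then have "n.ext d \<noteq> {}" using g(3)[of x0] bA MN unfolding d by blast
      then obtain y where y: "y \<in> n.ext d" "n.ext y \<inter> n.ext d = {}"
        using n.foundation[OF d(1)] by blast
      then obtain x where x: "x \<in> n.ext b" "related M E (m.ext g) x y"
        unfolding d by blast
      \<comment> \<open>A predecessor \<open>z\<close> of \<open>x\<close> in \<open>b\<close> would
        have its value \<open>w\<close> both in \<open>y\<close> and in \<open>d\<close>, against
        the minimality of \<open>y\<close>.\<close>
      have "\<not> related M E R z x" if z: "z \<in> n.ext b" for z
      proof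
        assume zx: "related M E R z x"
        obtain w where w: "w \<in> M" "related M E (m.ext g) z w" using g(3) z bA by blast
        have "w \<in> m.ext y" using g(4)[OF x(2) w(2) zx] w(1) by (simp add: ext_of_def)
        then have "w \<in> n.ext y" using ext m.related_in[OF x(2)] by blast
        moreover have "w \<in> n.ext d" unfolding d using w z MN by blast
        ultimately show False using y(2) by blast
      qed
      then show "\<exists>m\<in>n.ext b. \<not> (\<exists>x\<in>n.ext b. related N F R x m)"
        unfolding rel[OF RM] using x(1) by blast
    qed
  qed
qed

end
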